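(* Let $p\ge5$ be prime, $i\in\mathbb{N}_0$, and let $\gamma=\sum_{a=2}^{(p-1)/2}c_a\vartheta_a$ and $\gamma'=\sum_{a=2}^{(p-1)/2}c'_a\vartheta_a$ (with $c_a,c'_a\in K$) have restrictions to $\mathfrak{p}^i\wedge\mathfrak{p}^i$ lying in $\hat H_i$. Let $m$ be such that $L_{i,m}(\gamma)$ and $L_{i,m}(\gamma')$ are defined and have nilpotency class at most $p-1$. If there exist $u\in\mathcal{U}$ and $\sigma\in\mathrm{Gal}(K/\mathbb{Q}_p)$ with $$\sigma(c'_a)\equiv\rho_a(u)\,c_a \pmod{\mathfrak{p}^m}\quad\text{for all } 2\le a\le (p-1)/2,$$ then $S_{i,m}(\gamma)\cong S_{i,m}(\gamma')$.
   Context: Let $\theta$ be a primitive $p$-th root of unity, $K=\mathbb{Q}_p(\theta)$, $\mathcal{O}$ its ring of integers, $\mathcal{U}$ the unit group of $\mathcal{O}$, $\mathfrak{p}$ its maximal ideal; $\mathfrak{p}^j$ is the unique ideal of index $p^j$, $\mathfrak{p}^\infty=\{0\}$. $\sigma_j$ denotes the Galois automorphism $\theta\mapsto\theta^j$. For $a\in\{2,\dots,(p-1)/2\}$, $\vartheta_a:K\wedge K\to K$, $\vartheta_a(x\wedge y)=\sigma_a(x)\sigma_{1-a}(y)-\sigma_{1-a}(x)\sigma_a(y)$, and $\rho_a(u)=u^{-1}\sigma_a(u)\sigma_{1-a}(u)$ for $u\in\mathcal{U}$. $P=\langle\theta\rangle$ acts by multiplication on ideals and diagonally on exterior squares (over $\mathbb{Z}_p$);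 $\hat{H}_i=\{\gamma\in\mathrm{Hom}_P(\mathfrak{p}^i\wedge\mathfrak{p}^i,\mathfrak{p}^{2i+1}) \mid \gamma \text{ surjective}\}$. $J_i(\gamma)$ is the ideal generated by all $\gamma(\gamma(x\wedge y)\wedge z)+\gamma(\gamma(y\wedge z)\wedge x)+\gamma(\gamma(z\wedge x)\wedge y)$, $x,y,z\in\mathfrak{p}^i$, and $J_i(\gamma)=\mathfrak{p}^\ell$. For $i\le m\le\ell$, $L_{i,m}(\gamma)$ is $\mathfrak{p}^i/\mathfrak{p}^m$ with bracket $[a+\mathfrak{p}^m,b+\mathfrak{p}^m]=\gamma(a\wedge b)+\mathfrak{p}^m$. If it has class at most $p-1$, the Lazard correspondence gives a $p$-group $\mathbb{G}(L_{i,m}(\gamma))$ on the same set, on which multiplication by $\theta$ is an automorphism, and $S_{i,m}(\gamma)=\mathbb{G}(L_{i,m}(\gamma))\rtimes P$. *)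

theory Defs
  imports Complex_Main "HOL-Computational_Algebra.Primes" "HOL-Algebra.Group"
begin

(* The local field K = Q_p(theta), given abstractly.                   *)
(* K is the ambient type 'k (a field of characteristic 0), \<O> its ring  *)
(* of integers, theta a primitive p-th root of unity, pi = 1 - theta.  *)

definition pp :: "'k::field_char_0 set \<Rightarrow> 'k \<Rightarrow> nat \<Rightarrow> 'k set" where
  "pp \<O> \<theta> n = {(1 - \<theta>) ^ n * x | x. x \<in> \<O>}"

(* the axioms characterising (K, \<O>, theta) up to isomorphism as
   (Q_p(zeta_p), Z_p[zeta_p], zeta_p): \<O> is a complete discrete valuation
   ring with uniformiser 1-theta and residue field F_p, K = Frac \<O>, char K = 0 *)
definition padic_cyclo :: "nat \<Rightarrow> 'k::field_char_0 set \<Rightarrow> 'k \<Rightarrow> bool" where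
  "padic_cyclo p \<O> \<theta> \<longleftrightarrow>
     prime p \<and> \<theta> ^ p = 1 \<and> \<theta> \<noteq> 1 \<and> \<theta> \<in> \<O> \<and>
     0 \<in> \<O> \<and> 1 \<in> \<O> \<and>
     (\<forall>x\<in>\<O>. \<forall>y\<in>\<O>. x + y \<in> \<O> \<and> x * y \<in> \<O> \<and> - x \<in> \<O>) \<and>
     (\<forall>x\<in>\<O>. x \<notin> pp \<O> \<theta> 1 \<longrightarrow> inverse x \<in> \<O>) \<and>
     (\<Inter>n. pp \<O> \<theta> n) = {0} \<and>
     (\<forall>x. \<exists>k. (1 - \<theta>) ^ k * x \<in> \<O>) \<and>
     (\<forall>x\<in>\<O>. \<exists>j<p. x - of_nat j \<in> pp \<O> \<theta> 1) \<and>
     (\<forall>f. (\<forall>n. f n \<in> \<O> \<and> f (Suc n) - f n \<in> pp \<O> \<theta> n) \<longrightarrow>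
          (\<exists>x\<in>\<O>. \<forall>n. x - f n \<in> pp \<O> \<theta> n))"

definition galois_family :: "nat \<Rightarrow> 'k::field_char_0 set \<Rightarrow> 'k \<Rightarrow> (nat \<Rightarrow> 'k \<Rightarrow> 'k) \<Rightarrow> bool" where
  "galois_family p \<O> \<theta> \<sigma> \<longleftrightarrow>
     (\<forall>j\<in>{1..p-1}. bij (\<sigma> j) \<and>
        (\<forall>x y. \<sigma> j (x + y) = \<sigma> j x + \<sigma> j y \<and> \<sigma> j (x * y) = \<sigma> j x * \<sigma> j y) \<and>
        \<sigma> j ` \<O> = \<O> \<and> \<sigma> j \<theta> = \<theta> ^ j)"

definition unitsO :: "'k::field_char_0 set \<Rightarrow> 'k set" where
  "unitsO \<O> = {u \<in> \<O>. u \<noteq> 0 \<and> inverse u \<in> \<O>}"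

definition Zp :: "'k::field_char_0 set \<Rightarrow> 'k \<Rightarrow> 'k set" where
  "Zp \<O> \<theta> = {x \<in> \<O>. \<forall>n. \<exists>z::int. x - of_int z \<in> pp \<O> \<theta> n}"

(* R-span of a set S (R = Z_p: Z_p-submodule; R = \<O>: ideal; R = Z: subgroup) *)
inductive_set rspan :: "'k::field_char_0 set \<Rightarrow> 'k set \<Rightarrow> 'k set" for R S where
  zero: "0 \<in> rspan R S"
| gen: "r \<in> R \<Longrightarrow> s \<in> S \<Longrightarrow> r * s \<in> rspan R S"
| add: "a \<in> rspan R S \<Longrightarrow> b \<in> rspan R S \<Longrightarrow> a + b \<in> rspan R S"

(* theta_a(x /\ y), with sigma_{1-a} = sigma_{p+1-a} *)
definition vartheta :: "(nat \<Rightarrow> 'k \<Rightarrow> 'k) \<Rightarrow> nat \<Rightarrow> nat \<Rightarrow> 'k::field_char_0 \<Rightarrow> 'k \<Rightarrow> 'k" where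
  "vartheta \<sigma> p a x y = \<sigma> a x * \<sigma> (p + 1 - a) y - \<sigma> (p + 1 - a) x * \<sigma> a y"

(* gamma = sum_{a=2}^{(p-1)/2} c_a theta_a, as a function of (x,y) ~ x /\ y *)
definition gam :: "(nat \<Rightarrow> 'k \<Rightarrow> 'k) \<Rightarrow> nat \<Rightarrow> (nat \<Rightarrow> 'k) \<Rightarrow> 'k::field_char_0 \<Rightarrow> 'k \<Rightarrow> 'k" where
  "gam \<sigma> p c x y = (\<Sum>a\<in>{2..(p - 1) div 2}. c a * vartheta \<sigma> p a x y)"

definition rho :: "(nat \<Rightarrow> 'k \<Rightarrow> 'k) \<Rightarrow> nat \<Rightarrow> nat \<Rightarrow> 'k::field_char_0 \<Rightarrow> 'k" where
  "rho \<sigma> p a u = inverse u * \<sigma> a u * \<sigma> (p + 1 - a) u"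

(* beta (restricted to p^i x p^i, i.e. to pure wedges of p^i /\ p^i) lies in hat H_i:
   it is a Z_p-linear, P-equivariant map p^i /\ p^i -> p^{2i+1} which is surjective *)
definition hatH :: "'k::field_char_0 set \<Rightarrow> 'k \<Rightarrow> nat \<Rightarrow> ('k \<Rightarrow> 'k \<Rightarrow> 'k) \<Rightarrow> bool" where
  "hatH \<O> \<theta> i \<beta> \<longleftrightarrow>
     (\<forall>x\<in>pp \<O> \<theta> i. \<forall>y\<in>pp \<O> \<theta> i. \<beta> x y \<in> pp \<O> \<theta> (2 * i + 1)) \<and>
     (\<forall>x\<in>pp \<O> \<theta> i. \<beta> x x = 0) \<and>
     (\<forall>r\<in>Zp \<O> \<theta>. \<forall>x\<in>pp \<O> \<theta> i. \<forall>x'\<in>pp \<O> \<theta> i. \<forall>y\<in>pp \<O> \<theta> i.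
        \<beta> (r * x + x') y = r * \<beta> x y + \<beta> x' y \<and>
        \<beta> y (r * x + x') = r * \<beta> y x + \<beta> y x') \<and>
     (\<forall>x\<in>pp \<O> \<theta> i. \<forall>y\<in>pp \<O> \<theta> i. \<beta> (\<theta> * x) (\<theta> * y) = \<theta> * \<beta> x y) \<and>
     rspan (Zp \<O> \<theta>) {\<beta> x y | x y. x \<in> pp \<O> \<theta> i \<and> y \<in> pp \<O> \<theta> i} = pp \<O> \<theta> (2 * i + 1)"

definition Jid :: "'k::field_char_0 set \<Rightarrow> 'k \<Rightarrow> nat \<Rightarrow> ('k \<Rightarrow> 'k \<Rightarrow> 'k) \<Rightarrow> 'k set" where
  "Jid \<O> \<theta> i g = rspan \<O> {g (g x y) z + g (g y z) x + g (g z x) y | x y z.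
                             x \<in> pp \<O> \<theta> i \<and> y \<in> pp \<O> \<theta> i \<and> z \<in> pp \<O> \<theta> i}"

(* L_{i,m}(gamma) is defined: i <= m <= ell, where J_i(gamma) = p^ell
   (m <= ell  iff  p^ell \<subseteq> p^m) *)
definition Lie_defined :: "'k::field_char_0 set \<Rightarrow> 'k \<Rightarrow> nat \<Rightarrow> nat \<Rightarrow> ('k \<Rightarrow> 'k \<Rightarrow> 'k) \<Rightarrow> bool" where
  "Lie_defined \<O> \<theta> i m g \<longleftrightarrow> i \<le> m \<and> Jid \<O> \<theta> i g \<subseteq> pp \<O> \<theta> m"

(* lower central series of L_{i,m}(g), via preimages in p^i:
   lcs k is the preimage of gamma_{k+1}(L) *)
fun lcs :: "'k::field_char_0 set \<Rightarrow> 'k \<Rightarrow> nat \<Rightarrow> nat \<Rightarrow> ('k \<Rightarrow> 'k \<Rightarrow> 'k) \<Rightarrow> nat \<Rightarrow> 'k set" where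
  "lcs \<O> \<theta> i m g 0 = pp \<O> \<theta> i"
| "lcs \<O> \<theta> i m g (Suc k) =
     rspan (range of_int) ({g x y | x y. x \<in> pp \<O> \<theta> i \<and> y \<in> lcs \<O> \<theta> i m g k} \<union> pp \<O> \<theta> m)"

definition class_le :: "'k::field_char_0 set \<Rightarrow> 'k \<Rightarrow> nat \<Rightarrow> nat \<Rightarrow> ('k \<Rightarrow> 'k \<Rightarrow> 'k) \<Rightarrow> nat \<Rightarrow> bool" where
  "class_le \<O> \<theta> i m g c \<longleftrightarrow> lcs \<O> \<theta> i m g c \<subseteq> pp \<O> \<theta> m"

(* Baker-Campbell-Hausdorff series (Dynkin form), truncated at degree  *)
(* p-1; words over {X,Y} are bool lists, True = X, False = Y.          *)

definition is_block :: "bool list \<Rightarrow> bool" where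
  "is_block w \<longleftrightarrow> (\<exists>r s. r + s \<ge> 1 \<and> w = replicate r True @ replicate s False)"

definition block_wt :: "bool list \<Rightarrow> rat" where
  "block_wt w = 1 / (of_nat (fact (count_list w True)) * of_nat (fact (count_list w False)))"

(* coefficient of the word w in (e^X e^Y - 1)^n *)
fun blocks_coef :: "nat \<Rightarrow> bool list \<Rightarrow> rat" where
  "blocks_coef 0 w = (if w = [] then 1 else 0)"
| "blocks_coef (Suc n) w =
     (\<Sum>k\<in>{1..length w}. if is_block (take k w)
                          then block_wt (take k w) * blocks_coef n (drop k w) else 0)"

(* coefficient of the word w in log(e^X e^Y) *)
definition bch_coef :: "bool list \<Rightarrow> rat" where
  "bch_coef w = (\<Sum>n\<in>{1..length w}. (-1) ^ (n - 1) / of_nat n * blocks_coef n w)"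

fun rnb :: "('k \<Rightarrow> 'k \<Rightarrow> 'k) \<Rightarrow> 'k \<Rightarrow> 'k \<Rightarrow> bool list \<Rightarrow> 'k::field_char_0" where
  "rnb g x y [] = 0"
| "rnb g x y [a] = (if a then x else y)"
| "rnb g x y (a # w) = g (if a then x else y) (rnb g x y w)"

definition bch :: "nat \<Rightarrow> ('k \<Rightarrow> 'k \<Rightarrow> 'k) \<Rightarrow> 'k \<Rightarrow> 'k \<Rightarrow> 'k::field_char_0" where
  "bch p g x y = (\<Sum>d\<in>{1..<p}. \<Sum>w\<in>{w. length w = d}.
                    of_rat (bch_coef w / of_nat d) * rnb g x y w)"

definition coset :: "'k::field_char_0 set \<Rightarrow> 'k \<Rightarrow> nat \<Rightarrow> 'k \<Rightarrow> 'k set" where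
  "coset \<O> \<theta> m x = (\<lambda>z. x + z) ` pp \<O> \<theta> m"

definition lazard_group :: "nat \<Rightarrow> 'k::field_char_0 set \<Rightarrow> 'k \<Rightarrow> nat \<Rightarrow> nat \<Rightarrow> ('k \<Rightarrow> 'k \<Rightarrow> 'k) \<Rightarrow> 'k set monoid" where
  "lazard_group p \<O> \<theta> i m g =
     \<lparr>carrier = coset \<O> \<theta> m ` pp \<O> \<theta> i,
      mult = (\<lambda>A B. coset \<O> \<theta> m (bch p g (SOME a. a \<in> A) (SOME b. b \<in> B))),
      one = pp \<O> \<theta> m\<rparr>"

(* S_{i,m}(g) = G(L_{i,m}(g)) \<rtimes> P, P = <theta> acting by multiplication;
   the element (A, k) stands for A theta^k *)
definition S_grp :: "nat \<Rightarrow> 'k::field_char_0 set \<Rightarrow> 'k \<Rightarrow> nat \<Rightarrow> nat \<Rightarrow> ('k \<Rightarrow> 'k \<Rightarrow> 'k) \<Rightarrow> ('k set \<times> nat) monoid" where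
  "S_grp p \<O> \<theta> i m g =
     \<lparr>carrier = carrier (lazard_group p \<O> \<theta> i m g) \<times> {..<p},
      mult = (\<lambda>(A, k) (B, l). (mult (lazard_group p \<O> \<theta> i m g) A ((\<lambda>z. \<theta> ^ k * z) ` B),
                               (k + l) mod p)),
      one = (pp \<O> \<theta> m, 0)\<rparr>"

end

theory Submission
  imports Defs "HOL-Number_Theory.Cong"
begin

text \<open>
  The map \<open>x \<mapsto> u \<sigma>\<^sub>j(x)\<close> carries the bracket of \<open>\<gamma>'\<close> to that of \<open>\<gamma>\<close> modulo \<open>(1 - \<theta>)\<^sup>m \<O>\<close> and
  multiplication by \<open>\<theta>\<close> to multiplication by \<open>\<theta>\<^sup>j\<close>. The coefficients of the truncated
  Baker-Campbell-Hausdorff series are \<open>p\<close>-integral, so it preserves the Lazard products as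
  well, and \<open>(A, \<theta>\<^sup>k) \<mapsto> (u \<sigma>\<^sub>j(A), \<theta>\<^sup>j\<^sup>k)\<close> is an isomorphism.
\<close>

section \<open>Arithmetic of \<open>\<O>\<close> and of the powers of its maximal ideal\<close>

locale cyclo =
  fixes p :: nat and \<O> :: "'k::field_char_0 set" and \<theta> :: 'k
  assumes padic_cyclo: "padic_cyclo p \<O> \<theta>"
begin

lemma prime_p: "prime p" and theta_power_p: "\<theta> ^ p = 1" and theta_neq_1: "\<theta> \<noteq> 1"
  and theta_in_O: "\<theta> \<in> \<O>" and zero_in_O: "0 \<in> \<O>" and one_in_O: "1 \<in> \<O>"
  and O_add: "x \<in> \<O> \<Longrightarrow> y \<in> \<O> \<Longrightarrow> x + y \<in> \<O>"
  and O_mult: "x \<in> \<O> \<Longrightarrow> y \<in> \<O> \<Longrightarrow> x * y \<in> \<O>"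
  and O_uminus: "x \<in> \<O> \<Longrightarrow> - x \<in> \<O>"
  and O_inverse: "x \<in> \<O> \<Longrightarrow> x \<notin> pp \<O> \<theta> 1 \<Longrightarrow> inverse x \<in> \<O>"
  and pp_Inter: "(\<Inter>n. pp \<O> \<theta> n) = {0}"
  and K_fractions: "\<exists>k. (1 - \<theta>) ^ k * z \<in> \<O>"
  and residue_field: "x \<in> \<O> \<Longrightarrow> \<exists>j<p. x - of_nat j \<in> pp \<O> \<theta> 1"
  using padic_cyclo unfolding padic_cyclo_def by blast+

lemma O_diff: "x \<in> \<O> \<Longrightarrow> y \<in> \<O> \<Longrightarrow> x - y \<in> \<O>"
  using O_add[of x "- y"] O_uminus by simp

lemma O_power: "x \<in> \<O> \<Longrightarrow> x ^ n \<in> \<O>"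
  by (induction n) (auto intro: O_mult one_in_O)

lemma O_sum: "(\<And>x. x \<in> A \<Longrightarrow> f x \<in> \<O>) \<Longrightarrow> sum f A \<in> \<O>"
  by (induction A rule: infinite_finite_induct) (auto intro: O_add zero_in_O)

lemma O_of_nat: "of_nat n \<in> \<O>"
  by (induction n) (auto intro: O_add zero_in_O one_in_O)

lemma pp_0: "pp \<O> \<theta> 0 = \<O>"
  by (auto simp: pp_def)

lemma pp_zero: "0 \<in> pp \<O> \<theta> n"
  using zero_in_O by (force simp: pp_def)

lemma pp_add: assumes "x \<in> pp \<O> \<theta> n" "y \<in> pp \<O> \<theta> n" shows "x + y \<in> pp \<O> \<theta> n"
proof -
  obtain a b where "a \<in> \<O>" "b \<in> \<O>" "x = (1 - \<theta>) ^ n * a" "y = (1 - \<theta>) ^ n * b"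
    using assms by (auto simp: pp_def)
  then have "x + y = (1 - \<theta>) ^ n * (a + b)" "a + b \<in> \<O>"
    by (auto simp: distrib_left O_add)
  then show ?thesis
    unfolding pp_def by blast
qed

lemma pp_mult: assumes "r \<in> \<O>" "x \<in> pp \<O> \<theta> n" shows "r * x \<in> pp \<O> \<theta> n"
proof -
  obtain a where "a \<in> \<O>" "x = (1 - \<theta>) ^ n * a"
    using assms by (auto simp: pp_def)
  then have "r * x = (1 - \<theta>) ^ n * (r * a)" "r * a \<in> \<O>"
    using assms by (auto simp: O_mult)
  then show ?thesis
    unfolding pp_def by blast
qed

lemma pp_uminus: "x \<in> pp \<O> \<theta> n \<Longrightarrow> - x \<in> pp \<O> \<theta> n"
  using pp_mult[of "-1" x n] O_uminus[OF one_in_O] by simp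

lemma pp_diff: "x \<in> pp \<O> \<theta> n \<Longrightarrow> y \<in> pp \<O> \<theta> n \<Longrightarrow> x - y \<in> pp \<O> \<theta> n"
  using pp_add[of x n "- y"] pp_uminus by simp

lemma pp_sum: "(\<And>x. x \<in> A \<Longrightarrow> f x \<in> pp \<O> \<theta> n) \<Longrightarrow> sum f A \<in> pp \<O> \<theta> n"
  by (induction A rule: infinite_finite_induct) (auto intro: pp_add pp_zero)

lemma one_minus_theta_in_O: "1 - \<theta> \<in> \<O>"
  by (intro O_diff one_in_O theta_in_O)

lemma pp_antimono: assumes "n \<le> k" shows "pp \<O> \<theta> k \<subseteq> pp \<O> \<theta> n"
proof
  fix x assume "x \<in> pp \<O> \<theta> k"
  then obtain a where "a \<in> \<O>" "x = (1 - \<theta>) ^ k * a"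
    by (auto simp: pp_def)
  then have "x = (1 - \<theta>) ^ n * ((1 - \<theta>) ^ (k - n) * a)" "(1 - \<theta>) ^ (k - n) * a \<in> \<O>"
    using assms
    by (auto simp: O_mult O_power one_minus_theta_in_O simp flip: mult.assoc power_add)
  then show "x \<in> pp \<O> \<theta> n"
    unfolding pp_def by blast
qed

lemma pp_subset_O: "pp \<O> \<theta> n \<subseteq> \<O>"
  using pp_antimono[of 0 n] pp_0 by simp

text \<open>If \<open>1 - \<theta>\<close> were invertible in \<open>\<O>\<close>, all its powers
  would be too, so \<open>1\<close> would lie in every \<open>pp \<O> \<theta> n\<close>, against
  the intersection being zero.\<close>

lemma one_notin_pp: "1 \<notin> pp \<O> \<theta> 1"
proof
  assume "1 \<in> pp \<O> \<theta> 1"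
  then obtain a where a: "a \<in> \<O>" "1 = (1 - \<theta>) * a"
    by (auto simp: pp_def)
  have "1 \<in> pp \<O> \<theta> n" for n
  proof -
    have "1 = (1 - \<theta>) ^ n * a ^ n"
      using a(2) by (metis power_mult_distrib power_one)
    then show ?thesis
      unfolding pp_def using O_power[OF a(1)] by blast
  qed
  then have "1 \<in> (\<Inter>n. pp \<O> \<theta> n)"
    by blast
  then show False
    unfolding pp_Inter by simp
qed

text \<open>Since \<open>\<theta>\<close> is a root of \<open>1 + X + ... + X^(p-1)\<close>, the
  number \<open>p\<close> is the sum of the \<open>1 - \<theta> ^ k\<close> with
  \<open>k < p\<close>, and each of these is divisible by \<open>1 - \<theta>\<close>.\<close>

lemma p_in_pp: "of_nat p \<in> pp \<O> \<theta> 1"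
proof -
  have "(\<theta> - 1) * (\<Sum>k<p. \<theta> ^ k) = 0"
    using power_diff_1_eq[of \<theta> p] theta_power_p by simp
  then have "(\<Sum>k<p. \<theta> ^ k) = 0"
    using theta_neq_1 by simp
  then have "of_nat p = (\<Sum>k<p. 1 - \<theta> ^ k)"
    by (simp add: sum_subtractf)
  also have "\<dots> \<in> pp \<O> \<theta> 1"
  proof (rule pp_sum)
    fix k
    have "1 - \<theta> ^ k = (1 - \<theta>) ^ 1 * (\<Sum>i<k. \<theta> ^ i)"
      using one_diff_power_eq[of \<theta> k] by simp
    then show "1 - \<theta> ^ k \<in> pp \<O> \<theta> 1"
      unfolding pp_def using O_sum[of "{..<k}" "\<lambda>i. \<theta> ^ i"] O_power[OF theta_in_O] by blast
  qed
  finally show ?thesis .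
qed

text \<open>The maximal ideal contains \<open>p\<close>; if it also contained \<open>n\<close>, a
  Bezout relation would put \<open>1\<close> into it.\<close>

lemma inverse_of_nat_in_O: assumes "\<not> p dvd n" shows "inverse (of_nat n) \<in> \<O>"
proof (rule O_inverse[OF O_of_nat], rule notI)
  assume n: "of_nat n \<in> pp \<O> \<theta> 1"
  have "coprime n p"
    using prime_imp_coprime[OF prime_p assms] by (simp add: coprime_commute)
  moreover have "n \<noteq> 0"
    using assms by (intro notI) simp
  ultimately obtain x y where "n * x = p * y + 1"
    using bezout_nat[of n p] by auto
  then have "of_nat n * of_nat x = of_nat p * of_nat y + (1::'k)"
    by (metis of_nat_1 of_nat_add of_nat_mult)
  then have "1 = of_nat x * of_nat n - of_nat y * (of_nat p :: 'k)"
    by (simp add: algebra_simps)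
  also have "\<dots> \<in> pp \<O> \<theta> 1"
    by (intro pp_diff pp_mult O_of_nat n p_in_pp)
  finally show False
    using one_notin_pp by simp
qed

section \<open>Integrality of the truncated Baker-Campbell-Hausdorff coefficients\<close>

text \<open>This is the localisation of the integers at \<open>p\<close>, encoded through the
  embedding into the field so that its closure properties are inherited from
  \<open>\<O>\<close>.\<close>

definition p_integral :: "rat set" where
  "p_integral = {q. of_rat q \<in> \<O>}"

lemma p_integral_add: "q \<in> p_integral \<Longrightarrow> r \<in> p_integral \<Longrightarrow> q + r \<in> p_integral"
  by (simp add: p_integral_def of_rat_add O_add)

lemma p_integral_mult: "q \<in> p_integral \<Longrightarrow> r \<in> p_integral \<Longrightarrow> q * r \<in> p_integral"
  by (simp add: p_integral_def of_rat_mult O_mult)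

lemma p_integral_0_1: "0 \<in> p_integral" "1 \<in> p_integral" "- 1 \<in> p_integral"
  by (simp_all add: p_integral_def zero_in_O one_in_O O_uminus of_rat_minus)

lemma p_integral_power: "q \<in> p_integral \<Longrightarrow> q ^ n \<in> p_integral"
  by (simp add: p_integral_def of_rat_power O_power)

lemma p_integral_sum: "(\<And>x. x \<in> A \<Longrightarrow> f x \<in> p_integral) \<Longrightarrow> sum f A \<in> p_integral"
  by (induction A rule: infinite_finite_induct) (auto intro: p_integral_add p_integral_0_1)

lemma p_integral_divide: "q \<in> p_integral \<Longrightarrow> \<not> p dvd n \<Longrightarrow> q / of_nat n \<in> p_integral"
  by (simp add: p_integral_def of_rat_divide divide_inverse O_mult inverse_of_nat_in_O of_rat_mult
      of_rat_inverse)

text \<open>The denominators are factorials of letter counts, and these counts are below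
  \<open>p\<close>.\<close>

lemma p_integral_block_wt: assumes "length w < p" shows "block_wt w \<in> p_integral"
proof -
  have "\<not> p dvd fact (count_list w True)" "\<not> p dvd fact (count_list w False)"
    using assms prime_p by (metis count_le_length leD le_less_trans prime_dvd_fact_iff)+
  then have "\<not> p dvd fact (count_list w True) * fact (count_list w False)"
    using prime_p by (simp add: prime_dvd_mult_iff)
  from p_integral_divide[OF p_integral_0_1(2) this] show ?thesis
    by (simp add: block_wt_def)
qed

lemma p_integral_blocks_coef: "length w < p \<Longrightarrow> blocks_coef n w \<in> p_integral"
proof (induction n arbitrary: w)
  case (Suc n)
  then show ?case
    by (auto intro!: p_integral_sum p_integral_mult p_integral_block_wt simp: p_integral_0_1)
qed (simp add: p_integral_0_1)

lemma p_integral_bch_coef: assumes "length w < p" shows "bch_coef w \<in> p_integral"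
  unfolding bch_coef_def
proof (rule p_integral_sum, rule p_integral_mult)
  fix n assume n: "n \<in> {1..length w}"
  have "\<not> p dvd n"
    using n assms by (auto dest: dvd_imp_le)
  then show "(- 1) ^ (n - 1) / of_nat n \<in> p_integral"
    by (intro p_integral_divide p_integral_power p_integral_0_1)
qed (rule p_integral_blocks_coef[OF assms])

text \<open>The further denominator \<open>d\<close> is the degree by which the Dynkin form divides.
  Truncation below degree \<open>p\<close> keeps it, like all the other denominators, prime to
  \<open>p\<close>.\<close>

lemma bch_term_coef_in_O:
  assumes "d \<in> {1..<p}" "length w = d" shows "of_rat (bch_coef w / of_nat d) \<in> \<O>"
proof -
  have "\<not> p dvd d"
    using assms by (auto dest: dvd_imp_le)
  then have "bch_coef w / of_nat d \<in> p_integral"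
    using assms by (intro p_integral_divide p_integral_bch_coef) auto
  then show ?thesis
    by (simp add: p_integral_def)
qed

text \<open>Digits are found one at a time, each from the residue class of the current remainder
  divided by \<open>(1 - \<theta>) ^ n\<close>. The expansion makes polynomials in
  \<open>\<theta>\<close> dense in \<open>\<O>\<close>, which is what \<open>sigma_commute\<close>
  relies on.\<close>

lemma O_digits: "x \<in> \<O> \<Longrightarrow> \<exists>d. x - (\<Sum>k<n. of_nat (d k) * (1 - \<theta>) ^ k) \<in> pp \<O> \<theta> n"
proof (induction n)
  case 0
  then show ?case
    by (simp add: pp_0)
next
  case (Suc n)
  then obtain d where "x - (\<Sum>k<n. of_nat (d k) * (1 - \<theta>) ^ k) \<in> pp \<O> \<theta> n"
    by blast
  then obtain y where y: "y \<in> \<O>" "x - (\<Sum>k<n. of_nat (d k) * (1 - \<theta>) ^ k) = (1 - \<theta>) ^ n * y"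
    by (auto simp: pp_def)
  obtain j where "y - of_nat j \<in> pp \<O> \<theta> 1"
    using residue_field[OF y(1)] by blast
  then obtain z where z: "z \<in> \<O>" "y - of_nat j = (1 - \<theta>) * z"
    by (auto simp: pp_def)
  have "x - (\<Sum>k<Suc n. of_nat ((d(n := j)) k) * (1 - \<theta>) ^ k)
      = x - (\<Sum>k<n. of_nat (d k) * (1 - \<theta>) ^ k) - of_nat j * (1 - \<theta>) ^ n"
    by (simp add: diff_diff_eq)
  also have "\<dots> = (1 - \<theta>) ^ n * (y - of_nat j)"
    unfolding y(2) by (simp add: algebra_simps)
  also have "\<dots> = (1 - \<theta>) ^ Suc n * z"
    unfolding z(2) by simp
  finally show ?case
    using z(1) unfolding pp_def by blast
qed

section \<open>Cosets, their representatives and the maps induced on them\<close>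

lemma in_coset_iff: "y \<in> coset \<O> \<theta> m x \<longleftrightarrow> y - x \<in> pp \<O> \<theta> m"
proof -
  have "y = x + (y - x)"
    by simp
  then show ?thesis
    unfolding coset_def by (metis (no_types, lifting) add_diff_cancel_left' image_iff)
qed

lemma coset_eqI: assumes "x - y \<in> pp \<O> \<theta> m" shows "coset \<O> \<theta> m x = coset \<O> \<theta> m y"
proof -
  have "(z - x \<in> pp \<O> \<theta> m) \<longleftrightarrow> (z - y \<in> pp \<O> \<theta> m)" for z
  proof -
    have "z - x = (z - y) - (x - y)" "z - y = (z - x) + (x - y)"
      by auto
    then show ?thesis
      using assms pp_add pp_diff by metis
  qed
  then show ?thesis
    by (auto simp: in_coset_iff)
qed

text \<open>\<open>lazard_group\<close> multiplies representatives picked by \<open>SOME\<close>;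
  only their residue class is known.\<close>

lemma some_in_coset: "(SOME y. y \<in> coset \<O> \<theta> m x) - x \<in> pp \<O> \<theta> m"
proof -
  have "x \<in> coset \<O> \<theta> m x"
    by (simp add: in_coset_iff pp_zero)
  then have "(SOME y. y \<in> coset \<O> \<theta> m x) \<in> coset \<O> \<theta> m x"
    by (rule someI)
  then show ?thesis
    by (simp only: in_coset_iff)
qed

lemma in_pp_cong: "x \<in> pp \<O> \<theta> n \<Longrightarrow> y - x \<in> pp \<O> \<theta> n \<Longrightarrow> y \<in> pp \<O> \<theta> n"
  using pp_add by fastforce

text \<open>Exponents in the second component of \<open>S_grp\<close> are reduced modulo
  \<open>p\<close>; the action does not see the reduction.\<close>

lemma theta_power_mod: "\<theta> ^ (n mod p) = \<theta> ^ n"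
proof -
  have "\<theta> ^ n = \<theta> ^ (p * (n div p) + n mod p)"
    by simp
  also have "\<dots> = \<theta> ^ (n mod p)"
    by (simp only: power_add power_mult theta_power_p power_one mult_1)
  finally show ?thesis
    by simp
qed

lemma pp_scale: assumes "r \<in> \<O>" "s \<in> \<O>" "r * s = 1" shows "(\<lambda>z. r * z) ` pp \<O> \<theta> n = pp \<O> \<theta> n"
proof (intro subset_antisym subsetI)
  fix z assume "z \<in> pp \<O> \<theta> n"
  then have "s * z \<in> pp \<O> \<theta> n" "z = r * (s * z)"
    using assms by (auto intro: pp_mult simp flip: mult.assoc)
  then show "z \<in> (\<lambda>z. r * z) ` pp \<O> \<theta> n"
    by blast
qed (use assms in \<open>auto intro: pp_mult\<close>)

lemma pp_theta: "(\<lambda>z. \<theta> ^ k * z) ` pp \<O> \<theta> n = pp \<O> \<theta> n"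
proof (rule pp_scale)
  have "p > 0"
    using prime_p by (rule prime_gt_0_nat)
  \<comment> \<open>The inverse of \<open>\<theta>\<close> in \<open>\<O>\<close> is
    \<open>\<theta> ^ (p - 1)\<close>.\<close>
  have "\<theta> ^ k * (\<theta> ^ (p - 1)) ^ k = (\<theta> * \<theta> ^ (p - 1)) ^ k"
    by (simp add: power_mult_distrib)
  also have "\<theta> * \<theta> ^ (p - 1) = 1"
    using theta_power_p \<open>p > 0\<close> by (metis power_eq_if not_gr0)
  finally show "\<theta> ^ k * (\<theta> ^ (p - 1)) ^ k = 1"
    by simp
qed (intro O_power theta_in_O)+

lemma additive_coset_image:
  assumes "\<And>x y. f (x + y) = f x + f y" "f ` pp \<O> \<theta> m = pp \<O> \<theta> m"
  shows "f ` coset \<O> \<theta> m x = coset \<O> \<theta> m (f x)"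
proof -
  have "f ` coset \<O> \<theta> m x = (\<lambda>z. f x + z) ` (f ` pp \<O> \<theta> m)"
    by (simp add: coset_def image_image assms(1))
  then show ?thesis
    by (simp add: coset_def assms(2))
qed

section \<open>Transport of the truncated series and of the semidirect product\<close>

lemma bch_in_pp:
  assumes "\<And>x y. x \<in> pp \<O> \<theta> i \<Longrightarrow> y \<in> pp \<O> \<theta> i \<Longrightarrow> g x y \<in> pp \<O> \<theta> i"
    and "x \<in> pp \<O> \<theta> i" "y \<in> pp \<O> \<theta> i"
  shows "bch p g x y \<in> pp \<O> \<theta> i"
proof -
  have "rnb g x y w \<in> pp \<O> \<theta> i" for w
  proof (induction w)
    case (Cons a w)
    then show ?case
      by (cases w) (use assms in auto)
  qed (simp add: pp_zero)
  then show ?thesis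
    unfolding bch_def by (intro pp_sum pp_mult bch_term_coef_in_O) auto
qed

text \<open>Nested brackets are compared word by word and then summed with coefficients in
  \<open>\<O>\<close>, which preserve the congruence. The arguments \<open>X\<close> and
  \<open>Y\<close> are only congruent to \<open>f x\<close> and \<open>f y\<close>, so that
  arbitrary representatives may be inserted.\<close>

lemma bch_intertwine:
  fixes f :: "'k \<Rightarrow> 'k"
  assumes add: "\<And>x y. f (x + y) = f x + f y"
    and rat: "\<And>q x. f (of_rat q * x) = of_rat q * f x"
    and im_i: "f ` pp \<O> \<theta> i = pp \<O> \<theta> i" and "i \<le> m"
    and g'_closed: "\<And>x y. x \<in> pp \<O> \<theta> i \<Longrightarrow> y \<in> pp \<O> \<theta> i \<Longrightarrow> g' x y \<in> pp \<O> \<theta> i"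
    and g_cong: "\<And>x y x' y'. x \<in> pp \<O> \<theta> i \<Longrightarrow> y \<in> pp \<O> \<theta> i \<Longrightarrow> x' - x \<in> pp \<O> \<theta> m \<Longrightarrow>
      y' - y \<in> pp \<O> \<theta> m \<Longrightarrow> g x' y' - g x y \<in> pp \<O> \<theta> m"
    and hom: "\<And>x y. x \<in> pp \<O> \<theta> i \<Longrightarrow> y \<in> pp \<O> \<theta> i \<Longrightarrow> f (g' x y) - g (f x) (f y) \<in> pp \<O> \<theta> m"
    and x: "x \<in> pp \<O> \<theta> i" "X - f x \<in> pp \<O> \<theta> m"
    and y: "y \<in> pp \<O> \<theta> i" "Y - f y \<in> pp \<O> \<theta> m"
  shows "bch p g X Y - f (bch p g' x y) \<in> pp \<O> \<theta> m"
proof -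
  have f_0: "f 0 = 0"
    using add[of 0 0] by simp
  have f_sum: "f (sum h A) = (\<Sum>a\<in>A. f (h a))" for h :: "'a \<Rightarrow> 'k" and A
    by (induction A rule: infinite_finite_induct) (auto simp: add f_0)
  \<comment> \<open>Membership in \<open>pp \<O> \<theta> i\<close> is carried through the induction
    because \<open>hom\<close> and \<open>g_cong\<close> apply only there.\<close>
  have rnb: "rnb g' x y w \<in> pp \<O> \<theta> i \<and> rnb g X Y w - f (rnb g' x y w) \<in> pp \<O> \<theta> m" for w
  proof (induction w)
    case Nil
    then show ?case
      by (simp add: f_0 pp_zero)
  next
    case (Cons a w)
    show ?case
    proof (cases w)
      case Nil
      then show ?thesis
        using x y by simp
    next
      case (Cons b v)
      define z Z where "z = (if a then x else y)" and "Z = (if a then X else Y)"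
      have z: "z \<in> pp \<O> \<theta> i" "Z - f z \<in> pp \<O> \<theta> m"
        using x y by (auto simp: z_def Z_def)
      have r: "rnb g' x y (a # w) = g' z (rnb g' x y w)" "rnb g X Y (a # w) = g Z (rnb g X Y w)"
        by (simp_all add: Cons z_def Z_def)
      \<comment> \<open>The bracket of the two images under \<open>f\<close> is the intermediate
        term: \<open>g_cong\<close> links it to the bracket of \<open>Z\<close>, and
        \<open>hom\<close> to the image of the bracket of \<open>z\<close>.\<close>
      have "g Z (rnb g X Y w) - g (f z) (f (rnb g' x y w)) \<in> pp \<O> \<theta> m"
        using z Cons.IH im_i by (intro g_cong) auto
      moreover have "f (g' z (rnb g' x y w)) - g (f z) (f (rnb g' x y w)) \<in> pp \<O> \<theta> m"
        using z Cons.IH by (intro hom) auto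
      ultimately show ?thesis
        unfolding r using pp_diff g'_closed z(1) Cons.IH by fastforce
    qed
  qed
  have "bch p g X Y - f (bch p g' x y) =
      (\<Sum>d\<in>{1..<p}. \<Sum>w\<in>{w. length w = d}.
         of_rat (bch_coef w / of_nat d) * (rnb g X Y w - f (rnb g' x y w)))"
    by (simp only: bch_def f_sum rat sum_subtractf right_diff_distrib)
  also have "\<dots> \<in> pp \<O> \<theta> m"
    using rnb by (intro pp_sum pp_mult bch_term_coef_in_O) auto
  finally show ?thesis .
qed

text \<open>
  An arbitrary choice of coset representatives enters the multiplication, hence the
  hypothesis that the bracket is compatible with congruence modulo the ideal.
\<close>

lemma S_grp_iso_of_intertwiner:
  fixes f :: "'k \<Rightarrow> 'k"
  assumes add: "\<And>x y. f (x + y) = f x + f y"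
    and rat: "\<And>q x. f (of_rat q * x) = of_rat q * f x"
    and inj: "inj f"
    and theta: "\<And>x. f (\<theta> * x) = \<theta> ^ j * f x" and j: "j \<in> {1..p - 1}"
    and im: "\<And>n. f ` pp \<O> \<theta> n = pp \<O> \<theta> n" and im_le: "i \<le> m"
    and g'_closed: "\<And>x y. x \<in> pp \<O> \<theta> i \<Longrightarrow> y \<in> pp \<O> \<theta> i \<Longrightarrow> g' x y \<in> pp \<O> \<theta> i"
    and g_cong: "\<And>x y x' y'. x \<in> pp \<O> \<theta> i \<Longrightarrow> y \<in> pp \<O> \<theta> i \<Longrightarrow> x' - x \<in> pp \<O> \<theta> m \<Longrightarrow>
      y' - y \<in> pp \<O> \<theta> m \<Longrightarrow> g x' y' - g x y \<in> pp \<O> \<theta> m"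
    and hom: "\<And>x y. x \<in> pp \<O> \<theta> i \<Longrightarrow> y \<in> pp \<O> \<theta> i \<Longrightarrow> f (g' x y) - g (f x) (f y) \<in> pp \<O> \<theta> m"
  shows "(\<lambda>(A, k). (f ` A, j * k mod p)) \<in> iso (S_grp p \<O> \<theta> i m g') (S_grp p \<O> \<theta> i m g)"
proof -
  let ?C = "coset \<O> \<theta> m ` pp \<O> \<theta> i" and ?h = "\<lambda>(A, k). (f ` A, j * k mod p)"
  have p: "p > 0"
    using prime_p by (rule prime_gt_0_nat)
  have f_coset: "f ` coset \<O> \<theta> m x = coset \<O> \<theta> m (f x)" for x
    by (intro additive_coset_image add im)
  have theta_coset: "(\<lambda>z. \<theta> ^ k * z) ` coset \<O> \<theta> m x = coset \<O> \<theta> m (\<theta> ^ k * x)" for k x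
    by (intro additive_coset_image pp_theta) (simp add: distrib_left)
  have f_theta: "f (\<theta> ^ k * x) = \<theta> ^ (j * k) * f x" for k x
    by (induction k) (simp_all add: theta mult.assoc power_add)
  have car: "carrier (S_grp p \<O> \<theta> i m h) = ?C \<times> {..<p}" for h
    by (simp add: S_grp_def lazard_group_def)
  have mul: "(A, k) \<otimes>\<^bsub>S_grp p \<O> \<theta> i m h\<^esub> (B, l) =
      (coset \<O> \<theta> m (bch p h (SOME a. a \<in> A) (SOME b. b \<in> (\<lambda>z. \<theta> ^ k * z) ` B)), (k + l) mod p)"
    for A B h k l
    by (simp add: S_grp_def lazard_group_def)
  have bij_C: "bij_betw ((`) f) ?C ?C"
  proof (rule bij_betw_imageI)
    show "inj_on ((`) f) ?C"
      using inj by (meson inj_image_eq_iff inj_onI)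
    have "(`) f ` ?C = coset \<O> \<theta> m ` (f ` pp \<O> \<theta> i)"
      by (simp add: image_image f_coset)
    then show "(`) f ` ?C = ?C"
      by (simp add: im)
  qed
  have bij_p: "bij_betw (\<lambda>k. j * k mod p) {..<p} {..<p}"
  proof -
    have "\<not> p dvd j"
      using j by (auto dest: dvd_imp_le)
    then have "coprime j p"
      using prime_imp_coprime[OF prime_p] by (simp add: coprime_commute)
    then have inj_p: "inj_on (\<lambda>k. j * k mod p) {..<p}"
      by (intro inj_onI)
        (metis cong_def cong_less_modulus_unique_nat cong_mult_lcancel_nat lessThan_iff)
    have "(\<lambda>k. j * k mod p) ` {..<p} \<subseteq> {..<p}"
      using p by auto
    then have "(\<lambda>k. j * k mod p) ` {..<p} = {..<p}"
      using inj_p by (simp add: card_image card_subset_eq)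
    then show ?thesis
      using inj_p by (simp add: bij_betw_def)
  qed
  have bij: "bij_betw ?h (?C \<times> {..<p}) (?C \<times> {..<p})"
    using bij_betw_map_prod[OF bij_C bij_p] by (simp add: map_prod_def)
  have "?h ((A, k) \<otimes>\<^bsub>S_grp p \<O> \<theta> i m g'\<^esub> (B, l))
      = ?h (A, k) \<otimes>\<^bsub>S_grp p \<O> \<theta> i m g\<^esub> ?h (B, l)"
    if AB: "A \<in> ?C" "B \<in> ?C" for A B k l
  proof -
    obtain x y where x: "x \<in> pp \<O> \<theta> i" "A = coset \<O> \<theta> m x"
      and y: "y \<in> pp \<O> \<theta> i" "B = coset \<O> \<theta> m y"
      using AB by auto
    \<comment> \<open>The second factor enters the Lazard product only after
      \<open>\<theta> ^ k\<close> has acted on it.\<close>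
    define y' where "y' = \<theta> ^ k * y"
    have y': "y' \<in> pp \<O> \<theta> i"
      unfolding y'_def by (intro pp_mult O_power theta_in_O y)
    have B: "(\<lambda>z. \<theta> ^ k * z) ` B = coset \<O> \<theta> m y'"
      by (simp add: y y'_def theta_coset)
    \<comment> \<open>This is where the factor \<open>j\<close> in the second component is forced:
      applying \<open>f\<close> after \<open>\<theta> ^ k\<close> is the same as applying
      \<open>\<theta> ^ (j * k)\<close> after \<open>f\<close>.\<close>
    have fB: "(\<lambda>z. \<theta> ^ (j * k mod p) * z) ` f ` B = coset \<O> \<theta> m (f y')"
      by (simp add: y y'_def f_coset theta_coset theta_power_mod f_theta)
    define a b a' b' where "a = (SOME a. a \<in> coset \<O> \<theta> m x)" and "b = (SOME b. b \<in> coset \<O> \<theta> m y')"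
      and "a' = (SOME a. a \<in> coset \<O> \<theta> m (f x))" and "b' = (SOME b. b \<in> coset \<O> \<theta> m (f y'))"
    have rep: "a - x \<in> pp \<O> \<theta> m" "b - y' \<in> pp \<O> \<theta> m"
      "a' - f x \<in> pp \<O> \<theta> m" "b' - f y' \<in> pp \<O> \<theta> m"
      unfolding a_def b_def a'_def b'_def by (rule some_in_coset)+
    have ab: "a \<in> pp \<O> \<theta> i" "b \<in> pp \<O> \<theta> i"
      using rep x(1) y' pp_antimono[OF im_le] in_pp_cong by blast+
    have f_diff: "f (z - w) = f z - f w" for z w
      by (metis add add_diff_cancel_right' diff_add_cancel)
    have "f (a - x) \<in> pp \<O> \<theta> m" "f (b - y') \<in> pp \<O> \<theta> m"
      using rep(1,2) im by blast+
    \<comment> \<open>The representatives chosen in the target need not be images of those chosen in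
      the source, but they are congruent to them.\<close>
    then have "(a' - f x) - (f a - f x) \<in> pp \<O> \<theta> m" "(b' - f y') - (f b - f y') \<in> pp \<O> \<theta> m"
      unfolding f_diff using rep(3,4) pp_diff by blast+
    then have "a' - f a \<in> pp \<O> \<theta> m" "b' - f b \<in> pp \<O> \<theta> m"
      by simp_all
    then have "bch p g a' b' - f (bch p g' a b) \<in> pp \<O> \<theta> m"
      using ab by (intro bch_intertwine[of f i m g' g, OF add rat im im_le g'_closed g_cong hom])
    then have "coset \<O> \<theta> m (bch p g a' b') = f ` coset \<O> \<theta> m (bch p g' a b)"
      unfolding f_coset by (rule coset_eqI)
    moreover have "j * ((k + l) mod p) mod p = (j * k mod p + j * l mod p) mod p"
      by (metis distrib_left mod_add_eq mod_mult_right_eq)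
    ultimately show ?thesis
      unfolding prod.case mul B fB unfolding x(2) f_coset
      by (simp add: a_def b_def a'_def b'_def)
  qed
  then have mult: "?h (s \<otimes>\<^bsub>S_grp p \<O> \<theta> i m g'\<^esub> t)
      = ?h s \<otimes>\<^bsub>S_grp p \<O> \<theta> i m g\<^esub> ?h t"
    if "s \<in> ?C \<times> {..<p}" "t \<in> ?C \<times> {..<p}" for s t
    using that by (metis mem_Times_iff prod.collapse)
  show ?thesis
  proof (rule isoI[OF homI])
    show "bij_betw ?h (carrier (S_grp p \<O> \<theta> i m g')) (carrier (S_grp p \<O> \<theta> i m g))"
      unfolding car by (rule bij)
    then show "?h s \<in> carrier (S_grp p \<O> \<theta> i m g)"
      if "s \<in> carrier (S_grp p \<O> \<theta> i m g')" for s
      using that by (rule bij_betw_apply)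
  qed (unfold car, rule mult)
qed

text \<open>Closure allows the inverse of a bijective homomorphism to be evaluated on a product, and
  hence to be recognised as a homomorphism.\<close>

lemma S_grp_mult_closed:
  assumes "\<And>x y. x \<in> pp \<O> \<theta> i \<Longrightarrow> y \<in> pp \<O> \<theta> i \<Longrightarrow> g x y \<in> pp \<O> \<theta> i" and "i \<le> m"
    and "s \<in> carrier (S_grp p \<O> \<theta> i m g)" "t \<in> carrier (S_grp p \<O> \<theta> i m g)"
  shows "s \<otimes>\<^bsub>S_grp p \<O> \<theta> i m g\<^esub> t \<in> carrier (S_grp p \<O> \<theta> i m g)"
proof -
  obtain x k y l where s: "s = (coset \<O> \<theta> m x, k)" "x \<in> pp \<O> \<theta> i"
    and t: "t = (coset \<O> \<theta> m y, l)" "y \<in> pp \<O> \<theta> i"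
    using assms(3,4) by (auto simp: S_grp_def lazard_group_def)
  have "(\<lambda>z. \<theta> ^ k * z) ` coset \<O> \<theta> m y = coset \<O> \<theta> m (\<theta> ^ k * y)"
    by (intro additive_coset_image pp_theta) (simp add: distrib_left)
  moreover have "\<theta> ^ k * y \<in> pp \<O> \<theta> i"
    by (intro pp_mult O_power theta_in_O t)
  moreover have "(SOME a. a \<in> coset \<O> \<theta> m z) \<in> pp \<O> \<theta> i" if "z \<in> pp \<O> \<theta> i" for z
    using some_in_coset[of m z] that pp_antimono[OF assms(2)] in_pp_cong by blast
  moreover have "p > 0"
    using prime_p by (rule prime_gt_0_nat)
  ultimately show ?thesis
    using s t bch_in_pp[of i g, OF assms(1)] by (auto simp: S_grp_def lazard_group_def)
qed

section \<open>Lower central series and the ideal property\<close>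

lemma pp_subset_lcs: "pp \<O> \<theta> m \<subseteq> lcs \<O> \<theta> i m g (Suc k)"
proof
  fix x assume "x \<in> pp \<O> \<theta> m"
  \<comment> \<open>Generators enter \<open>rspan\<close> only with a scalar in front, hence the
    factor \<open>of_int 1\<close>.\<close>
  then have "of_int 1 * x \<in> lcs \<O> \<theta> i m g (Suc k)"
    unfolding lcs.simps by (intro rspan.gen rangeI UnI2)
  then show "x \<in> lcs \<O> \<theta> i m g (Suc k)"
    by simp
qed

text \<open>
  Nilpotency of the quotient forces the congruence subgroup to be an ideal, since each term of
  the lower central series contains it and the last one equals it.
\<close>

lemma class_le_imp_ideal:
  assumes "class_le \<O> \<theta> i m g n" "n \<ge> 2" "x \<in> pp \<O> \<theta> i" "y \<in> pp \<O> \<theta> m"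
  shows "g x y \<in> pp \<O> \<theta> m"
proof -
  \<comment> \<open>With \<open>n\<close> at least 2 the term before the last has a successor index,
    so \<open>pp_subset_lcs\<close> applies to it.\<close>
  obtain k where n: "n = Suc (Suc k)"
    using assms(2) by (metis One_nat_def Suc_1 Suc_le_D Suc_le_mono)
  have "y \<in> lcs \<O> \<theta> i m g (Suc k)"
    using assms(4) pp_subset_lcs by blast
  then have "of_int 1 * g x y \<in> lcs \<O> \<theta> i m g n"
    unfolding n lcs.simps(2)[of _ _ _ _ _ "Suc k"] using assms(3)
    by (intro rspan.gen rangeI UnI1) blast
  then show ?thesis
    using assms(1) by (auto simp: class_le_def)
qed

end

section \<open>Galois automorphisms and their action on the ideals\<close>

locale cyclo_galois = cyclo p \<O> \<theta>
  for p :: nat and \<O> :: "'k::field_char_0 set" and \<theta> :: 'k +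
  fixes \<sigma> :: "nat \<Rightarrow> 'k \<Rightarrow> 'k"
  assumes galois_family: "galois_family p \<O> \<theta> \<sigma>"
begin

context
  fixes j :: nat
  assumes j: "j \<in> {1..p - 1}"
begin

lemma sigma_bij: "bij (\<sigma> j)"
  and sigma_add: "\<sigma> j (x + y) = \<sigma> j x + \<sigma> j y"
  and sigma_mult: "\<sigma> j (x * y) = \<sigma> j x * \<sigma> j y"
  and sigma_O: "\<sigma> j ` \<O> = \<O>" and sigma_theta: "\<sigma> j \<theta> = \<theta> ^ j"
  using galois_family j unfolding galois_family_def by blast+

lemma sigma_0: "\<sigma> j 0 = 0"
  using sigma_add[of 0 0] by simp

lemma sigma_1: "\<sigma> j 1 = 1"
proof -
  \<comment> \<open>The image of \<open>1\<close> is idempotent, so it is \<open>1\<close> as soon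
    as it is nonzero.\<close>
  have "\<sigma> j 1 \<noteq> 0"
    using sigma_0 bij_is_inj[OF sigma_bij] by (metis inj_eq zero_neq_one)
  then show ?thesis
    using sigma_mult[of 1 1] by simp
qed

lemma sigma_uminus: "\<sigma> j (- x) = - \<sigma> j x"
  using sigma_add[of x "- x"] sigma_0 by (simp add: eq_neg_iff_add_eq_0 add.commute)

lemma sigma_diff: "\<sigma> j (x - y) = \<sigma> j x - \<sigma> j y"
  using sigma_add[of x "- y"] sigma_uminus by simp

lemma sigma_power: "\<sigma> j (x ^ n) = \<sigma> j x ^ n"
  by (induction n) (simp_all add: sigma_1 sigma_mult)

lemma sigma_sum: "\<sigma> j (sum f A) = (\<Sum>a\<in>A. \<sigma> j (f a))"
  by (induction A rule: infinite_finite_induct) (simp_all add: sigma_0 sigma_add)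

lemma sigma_of_nat: "\<sigma> j (of_nat n) = of_nat n"
  by (induction n) (simp_all add: sigma_0 sigma_1 sigma_add)

lemma sigma_of_int: "\<sigma> j (of_int n) = of_int n"
  by (cases n) (simp_all add: sigma_of_nat sigma_uminus sigma_diff sigma_1)

lemma sigma_of_rat: "\<sigma> j (of_rat q) = of_rat q"
proof (cases q)
  case (Fract a b)
  have "\<sigma> j (of_rat q) * \<sigma> j (of_int b) = \<sigma> j (of_int a)"
    using Fract by (simp add: of_rat_rat flip: sigma_mult)
  then show ?thesis
    using Fract by (simp add: sigma_of_int of_rat_rat field_simps)
qed

lemma sigma_in_O: "x \<in> \<O> \<Longrightarrow> \<sigma> j x \<in> \<O>"
  using sigma_O by blast

text \<open>The elements \<open>1 - \<theta>\<close> and \<open>1 - \<theta> ^ j\<close> divide each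
  other in \<open>\<O>\<close>: with \<open>j'\<close> inverse to \<open>j\<close> modulo
  \<open>p\<close>, \<open>\<theta>\<close> is the \<open>j'\<close>-th power of
  \<open>\<theta> ^ j\<close>. So the automorphism sends the uniformiser to an associate of
  it.\<close>

lemma sigma_pp: "\<sigma> j ` pp \<O> \<theta> n = pp \<O> \<theta> n"
proof -
  have factor: "\<exists>e\<in>\<O>. 1 - x ^ k = (1 - x) * e" if "x \<in> \<O>" for x k
    using one_diff_power_eq[of x k] O_sum[of "{..<k}" "\<lambda>i. x ^ i"] O_power[OF that] by blast
  obtain e where e: "e \<in> \<O>" "1 - \<theta> ^ j = (1 - \<theta>) * e"
    using factor[OF theta_in_O] by blast
  have "\<not> p dvd j"
    using j by (auto dest: dvd_imp_le)
  then have "coprime j p"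
    using prime_imp_coprime[OF prime_p] by (simp add: coprime_commute)
  then obtain j' where "[j * j' = 1] (mod p)"
    using cong_solve_coprime_nat by fastforce
  then have "\<theta> ^ (j * j') = \<theta>"
    using theta_power_mod[of "j * j'"] theta_power_mod[of 1] by (simp add: cong_def)
  then obtain e' where e': "e' \<in> \<O>" "1 - \<theta> = (1 - \<theta> ^ j) * e'"
    using factor[OF O_power[OF theta_in_O], of j j'] by (metis power_mult)
  have sigma_pi: "\<sigma> j ((1 - \<theta>) ^ n * x) = (1 - \<theta> ^ j) ^ n * \<sigma> j x" for x
    by (simp add: sigma_mult sigma_power sigma_diff sigma_1 sigma_theta)
  show ?thesis
  proof (intro subset_antisym subsetI)
    fix y assume "y \<in> \<sigma> j ` pp \<O> \<theta> n"
    then obtain x where "x \<in> \<O>" "y = \<sigma> j ((1 - \<theta>) ^ n * x)"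
      by (auto simp: pp_def)
    then have "y = (1 - \<theta>) ^ n * (e ^ n * \<sigma> j x)" "e ^ n * \<sigma> j x \<in> \<O>"
      using e by (simp_all add: sigma_pi power_mult_distrib O_mult O_power sigma_in_O)
    then show "y \<in> pp \<O> \<theta> n"
      unfolding pp_def by blast
  next
    fix y assume "y \<in> pp \<O> \<theta> n"
    then obtain x where x: "x \<in> \<O>" "y = (1 - \<theta>) ^ n * x"
      by (auto simp: pp_def)
    have "e' ^ n * x \<in> \<O>"
      using x e' by (simp add: O_mult O_power)
    then obtain z where z: "z \<in> \<O>" "\<sigma> j z = e' ^ n * x"
      using sigma_O by (metis imageE)
    have "y = (1 - \<theta> ^ j) ^ n * \<sigma> j z"
      using x(2) e'(2) z(2) by (metis mult.assoc power_mult_distrib)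
    also have "\<dots> = \<sigma> j ((1 - \<theta>) ^ n * z)"
      by (simp add: sigma_pi)
    finally show "y \<in> \<sigma> j ` pp \<O> \<theta> n"
      unfolding pp_def using z(1) by blast
  qed
qed

lemma sigma_in_pp: "x \<in> pp \<O> \<theta> n \<Longrightarrow> \<sigma> j x \<in> pp \<O> \<theta> n"
  using sigma_pp by blast

end

text \<open>The automorphisms commute on the dense subring generated by \<open>\<theta>\<close>, hence everywhere.\<close>

lemma sigma_commute:
  assumes j: "j \<in> {1..p - 1}" and a: "a \<in> {1..p - 1}"
  shows "\<sigma> j (\<sigma> a x) = \<sigma> a (\<sigma> j x)"
proof -
  note hom = sigma_mult sigma_power sigma_diff sigma_1 sigma_theta sigma_sum sigma_of_nat
  \<comment> \<open>Both composites send \<open>\<theta>\<close> to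
    \<open>\<theta> ^ (a * j)\<close>.\<close>
  have pi: "\<sigma> j (\<sigma> a ((1 - \<theta>) ^ n)) = \<sigma> a (\<sigma> j ((1 - \<theta>) ^ n))" for n
    by (simp add: hom[OF j] hom[OF a] mult.commute flip: power_mult)
  have O: "\<sigma> j (\<sigma> a y) = \<sigma> a (\<sigma> j y)" if y: "y \<in> \<O>" for y
  proof -
    have "\<sigma> j (\<sigma> a y) - \<sigma> a (\<sigma> j y) \<in> pp \<O> \<theta> n" for n
    proof -
      obtain d where d: "y - (\<Sum>k<n. of_nat (d k) * (1 - \<theta>) ^ k) \<in> pp \<O> \<theta> n"
        using O_digits[OF y] by blast
      define z where "z = (\<Sum>k<n. of_nat (d k) * (1 - \<theta>) ^ k)"
      have z: "\<sigma> j (\<sigma> a z) = \<sigma> a (\<sigma> j z)"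
        by (simp add: z_def sigma_sum[OF j] sigma_sum[OF a] sigma_mult[OF j] sigma_mult[OF a]
            sigma_of_nat[OF j] sigma_of_nat[OF a] pi)
      have "\<sigma> j (\<sigma> a (y - z)) - \<sigma> a (\<sigma> j (y - z)) \<in> pp \<O> \<theta> n"
        using sigma_in_pp[OF j sigma_in_pp[OF a d]] sigma_in_pp[OF a sigma_in_pp[OF j d]]
        unfolding z_def by (rule pp_diff)
      then show ?thesis
        by (simp add: sigma_diff[OF j] sigma_diff[OF a] z)
    qed
    then have "\<sigma> j (\<sigma> a y) - \<sigma> a (\<sigma> j y) \<in> (\<Inter>n. pp \<O> \<theta> n)"
      by blast
    then show ?thesis
      unfolding pp_Inter by simp
  qed
  \<comment> \<open>A power of \<open>1 - \<theta>\<close> clears the denominator of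
    \<open>x\<close>; its image is nonzero and can be cancelled afterwards.\<close>
  obtain k where k: "(1 - \<theta>) ^ k * x \<in> \<O>"
    using K_fractions by blast
  have "(1 - \<theta>) ^ k \<noteq> 0"
    using theta_neq_1 by simp
  then have "\<sigma> a (\<sigma> j ((1 - \<theta>) ^ k)) \<noteq> 0"
    using sigma_0[OF j] sigma_0[OF a] bij_is_inj[OF sigma_bij[OF j]] bij_is_inj[OF sigma_bij[OF a]]
    by (metis inj_eq)
  then show ?thesis
    using O[OF k] pi[of k] by (simp add: sigma_mult[OF j] sigma_mult[OF a])
qed

text \<open>The index \<open>p + 1 - a\<close> stands for \<open>1 - a\<close> modulo
  \<open>p\<close>; it is at most \<open>p - 1\<close> exactly because \<open>a\<close> starts at
  2.\<close>

lemma index_range: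
  assumes "a \<in> {2..(p - 1) div 2}"
  shows "a \<in> {1..p - 1}" "p + 1 - a \<in> {1..p - 1}"
  using assms by auto

section \<open>The bracket \<open>gam\<close>: additivity, congruences and transformation by
  units\<close>

lemma gam_add:
  "gam \<sigma> p c (x + x') y = gam \<sigma> p c x y + gam \<sigma> p c x' y"
  "gam \<sigma> p c x (y + y') = gam \<sigma> p c x y + gam \<sigma> p c x y'"
proof -
  have "vartheta \<sigma> p a (x + x') y = vartheta \<sigma> p a x y + vartheta \<sigma> p a x' y"
    "vartheta \<sigma> p a x (y + y') = vartheta \<sigma> p a x y + vartheta \<sigma> p a x y'"
    if "a \<in> {2..(p - 1) div 2}" for a
    unfolding vartheta_def sigma_add[OF index_range(1)[OF that]] sigma_add[OF index_range(2)[OF that]]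
    by (simp_all only: distrib_left distrib_right add_diff_add)
  then show "gam \<sigma> p c (x + x') y = gam \<sigma> p c x y + gam \<sigma> p c x' y"
    "gam \<sigma> p c x (y + y') = gam \<sigma> p c x y + gam \<sigma> p c x y'"
    by (simp_all add: gam_def distrib_left flip: sum.distrib)
qed

lemma gam_commute: "gam \<sigma> p c x y = - gam \<sigma> p c y x"
  by (simp add: gam_def vartheta_def algebra_simps flip: sum_negf)

text \<open>Additivity splits the difference into a bracket with \<open>y' - y\<close> and one with
  \<open>x' - x\<close>; antisymmetry moves the latter into the second slot, where
  \<open>ideal\<close> applies.\<close>

lemma gam_cong:
  assumes ideal: "\<And>x y. x \<in> pp \<O> \<theta> i \<Longrightarrow> y \<in> pp \<O> \<theta> m \<Longrightarrow> gam \<sigma> p c x y \<in> pp \<O> \<theta> m"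
    and "i \<le> m" "x \<in> pp \<O> \<theta> i" "y \<in> pp \<O> \<theta> i" "x' - x \<in> pp \<O> \<theta> m" "y' - y \<in> pp \<O> \<theta> m"
  shows "gam \<sigma> p c x' y' - gam \<sigma> p c x y \<in> pp \<O> \<theta> m"
proof -
  have y': "y' \<in> pp \<O> \<theta> i"
    using assms(2,4,6) pp_antimono in_pp_cong by blast
  have "gam \<sigma> p c x' y' - gam \<sigma> p c x y =
      gam \<sigma> p c x (y' - y) - gam \<sigma> p c y' (x' - x)"
    using gam_add(1)[of c x "x' - x" y'] gam_add(2)[of c x y "y' - y"]
      gam_commute[of c "x' - x" y'] by simp
  also have "\<dots> \<in> pp \<O> \<theta> m"
    by (rule pp_diff[OF ideal[OF assms(3,6)] ideal[OF y' assms(5)]])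
  finally show ?thesis .
qed

text \<open>
  Replacing \<open>c\<^sub>a\<close> by \<open>\<rho>\<^sub>a(u) c\<^sub>a\<close> turns the bracket \<open>\<gamma>(x, y)\<close> into \<open>u\<^sup>-\<^sup>1 \<gamma>(u x, u y)\<close>.
\<close>

lemma gam_intertwine:
  assumes j: "j \<in> {1..p - 1}" and u: "u \<in> unitsO \<O>"
    and cong: "\<And>a. a \<in> {2..(p - 1) div 2} \<Longrightarrow> \<sigma> j (c' a) - rho \<sigma> p a u * c a \<in> pp \<O> \<theta> m"
    and x: "x \<in> \<O>" and y: "y \<in> \<O>"
  shows "u * \<sigma> j (gam \<sigma> p c' x y) - gam \<sigma> p c (u * \<sigma> j x) (u * \<sigma> j y) \<in> pp \<O> \<theta> m"
proof -
  have u': "u \<in> \<O>" "u \<noteq> 0"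
    using u by (auto simp: unitsO_def)
  let ?I = "{2..(p - 1) div 2}"
  \<comment> \<open>Commutativity of the automorphisms lets \<open>\<sigma> j\<close> pass inside
    \<open>vartheta\<close> to its arguments.\<close>
  have 1: "u * \<sigma> j (gam \<sigma> p c' x y) = (\<Sum>a\<in>?I. u * \<sigma> j (c' a) * vartheta \<sigma> p a (\<sigma> j x) (\<sigma> j y))"
    unfolding gam_def sigma_sum[OF j] sum_distrib_left
  proof (rule sum.cong[OF refl])
    fix a assume "a \<in> ?I"
    note a = index_range[OF this]
    show "u * \<sigma> j (c' a * vartheta \<sigma> p a x y)
        = u * \<sigma> j (c' a) * vartheta \<sigma> p a (\<sigma> j x) (\<sigma> j y)"
      unfolding vartheta_def sigma_mult[OF j] sigma_diff[OF j]
        sigma_commute[OF j a(1)] sigma_commute[OF j a(2)] by (rule mult.assoc[symmetric])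
  qed
  \<comment> \<open>Both products in \<open>vartheta\<close> release the same factor
    \<open>\<sigma> a u * \<sigma> (p + 1 - a) u\<close>, which is
    \<open>u * rho \<sigma> p a u\<close>.\<close>
  have 2: "gam \<sigma> p c (u * \<sigma> j x) (u * \<sigma> j y)
      = (\<Sum>a\<in>?I. u * (rho \<sigma> p a u * c a) * vartheta \<sigma> p a (\<sigma> j x) (\<sigma> j y))"
    unfolding gam_def
  proof (rule sum.cong[OF refl])
    fix a assume "a \<in> ?I"
    note a = index_range[OF this]
    show "c a * vartheta \<sigma> p a (u * \<sigma> j x) (u * \<sigma> j y)
        = u * (rho \<sigma> p a u * c a) * vartheta \<sigma> p a (\<sigma> j x) (\<sigma> j y)"
      unfolding vartheta_def rho_def sigma_mult[OF a(1)] sigma_mult[OF a(2)]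
      using u'(2) by (simp add: field_simps)
  qed
  \<comment> \<open>The defect is a combination of the given coefficient congruences with
    multipliers in \<open>\<O>\<close>.\<close>
  have "u * \<sigma> j (gam \<sigma> p c' x y) - gam \<sigma> p c (u * \<sigma> j x) (u * \<sigma> j y)
      = (\<Sum>a\<in>?I. (u * vartheta \<sigma> p a (\<sigma> j x) (\<sigma> j y)) * (\<sigma> j (c' a) - rho \<sigma> p a u * c a))"
    unfolding 1 2 sum_subtractf[symmetric] by (rule sum.cong[OF refl]) (simp add: algebra_simps)
  also have "\<dots> \<in> pp \<O> \<theta> m"
  proof (rule pp_sum, rule pp_mult)
    fix a assume I: "a \<in> ?I"
    note a = index_range[OF I]
    show "u * vartheta \<sigma> p a (\<sigma> j x) (\<sigma> j y) \<in> \<O>"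
      unfolding vartheta_def by (intro O_mult O_diff u' sigma_in_O a j x y)
  qed (rule cong)
  finally show ?thesis .
qed

end

section \<open>The isomorphism of semidirect products and its inverse\<close>

theorem theorem5p2:
  fixes p :: nat and \<O> :: "'k::field_char_0 set" and \<theta> :: 'k
    and \<sigma> :: "nat \<Rightarrow> 'k \<Rightarrow> 'k" and i m :: nat and c c' :: "nat \<Rightarrow> 'k"
  assumes "prime p" and "p \<ge> 5"
    and "padic_cyclo p \<O> \<theta>" and "galois_family p \<O> \<theta> \<sigma>"
    and "hatH \<O> \<theta> i (gam \<sigma> p c)" and "hatH \<O> \<theta> i (gam \<sigma> p c')"
    and "Lie_defined \<O> \<theta> i m (gam \<sigma> p c)" and "Lie_defined \<O> \<theta> i m (gam \<sigma> p c')"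
    and "class_le \<O> \<theta> i m (gam \<sigma> p c) (p - 1)" and "class_le \<O> \<theta> i m (gam \<sigma> p c') (p - 1)"
    and "\<exists>u\<in>unitsO \<O>. \<exists>j\<in>{1..p-1}.
           \<forall>a\<in>{2..(p - 1) div 2}. \<sigma> j (c' a) - rho \<sigma> p a u * c a \<in> pp \<O> \<theta> m"
  shows "S_grp p \<O> \<theta> i m (gam \<sigma> p c) \<cong> S_grp p \<O> \<theta> i m (gam \<sigma> p c')"
proof -
  interpret cyclo_galois p \<O> \<theta> \<sigma>
    using assms(3,4) by unfold_locales
  obtain u j where u: "u \<in> unitsO \<O>" and j: "j \<in> {1..p - 1}"
    and cong: "\<And>a. a \<in> {2..(p - 1) div 2} \<Longrightarrow> \<sigma> j (c' a) - rho \<sigma> p a u * c a \<in> pp \<O> \<theta> m"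
    using assms(11) by blast
  let ?S = "S_grp p \<O> \<theta> i m (gam \<sigma> p c)" and ?S' = "S_grp p \<O> \<theta> i m (gam \<sigma> p c')"
  let ?f = "\<lambda>x. u * \<sigma> j x" and ?h = "\<lambda>(A, k). ((\<lambda>x. u * \<sigma> j x) ` A, j * k mod p)"
  have u': "u \<in> \<O>" "inverse u \<in> \<O>" "u \<noteq> 0"
    using u by (auto simp: unitsO_def)
  have im_le: "i \<le> m"
    using assms(7) by (simp add: Lie_defined_def)
  \<comment> \<open>The values lie in the ideal of exponent \<open>2 * i + 1\<close>, which is at
    least \<open>i\<close>.\<close>
  have closed: "gam \<sigma> p c' x y \<in> pp \<O> \<theta> i" if "x \<in> pp \<O> \<theta> i" "y \<in> pp \<O> \<theta> i" for x y
    using assms(6) that pp_antimono[of i "2 * i + 1"] unfolding hatH_def by auto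
  \<comment> \<open>The class bound \<open>p - 1\<close> is at least 2 since
    \<open>p \<ge> 5\<close>.\<close>
  have ideal: "gam \<sigma> p c x y \<in> pp \<O> \<theta> m" if "x \<in> pp \<O> \<theta> i" "y \<in> pp \<O> \<theta> m" for x y
    using class_le_imp_ideal[OF assms(9)] assms(2) that by simp
  \<comment> \<open>As the congruence applies the automorphism to the coefficients
    \<open>c'\<close>, the natural map starts from the primed group; its inverse gives the direction
    claimed.\<close>
  have "?h \<in> iso ?S' ?S"
  proof (rule S_grp_iso_of_intertwiner[of ?f j i m])
    show "inj ?f"
      using u'(3) bij_is_inj[OF sigma_bij[OF j]] by (auto simp: inj_def)
    show "?f ` pp \<O> \<theta> n = pp \<O> \<theta> n" for n
      using pp_scale[of u "inverse u" n] u' sigma_pp[OF j, of n] by (metis image_image right_inverse)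
    show "?f (gam \<sigma> p c' x y) - gam \<sigma> p c (?f x) (?f y) \<in> pp \<O> \<theta> m"
      if "x \<in> pp \<O> \<theta> i" "y \<in> pp \<O> \<theta> i" for x y
      using that pp_subset_O by (intro gam_intertwine[OF j u cong]) auto
    show "gam \<sigma> p c x' y' - gam \<sigma> p c x y \<in> pp \<O> \<theta> m"
      if "x \<in> pp \<O> \<theta> i" "y \<in> pp \<O> \<theta> i" "x' - x \<in> pp \<O> \<theta> m" "y' - y \<in> pp \<O> \<theta> m" for x y x' y'
      using gam_cong[OF ideal im_le that] .
  qed (use j in \<open>simp_all add: sigma_add[OF j] sigma_mult[OF j] sigma_of_rat[OF j]
      sigma_theta[OF j] distrib_left im_le closed\<close>)
  then have hom: "?h \<in> hom ?S' ?S" and bij: "bij_betw ?h (carrier ?S') (carrier ?S)"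
    by (simp_all add: iso_def)
  have "inv_into (carrier ?S') ?h \<in> iso ?S ?S'"
  proof (rule isoI[OF homI])
    show bij': "bij_betw (inv_into (carrier ?S') ?h) (carrier ?S) (carrier ?S')"
      using bij by (rule bij_betw_inv_into)
    then show "inv_into (carrier ?S') ?h s \<in> carrier ?S'" if "s \<in> carrier ?S" for s
      using that by (rule bij_betw_apply)
    fix s t assume "s \<in> carrier ?S" "t \<in> carrier ?S"
    then obtain s' t' where s: "s' \<in> carrier ?S'" "s = ?h s'" and t: "t' \<in> carrier ?S'" "t = ?h t'"
      using bij unfolding bij_betw_def by blast
    have st: "s' \<otimes>\<^bsub>?S'\<^esub> t' \<in> carrier ?S'"
      using S_grp_mult_closed[of i "gam \<sigma> p c'", OF closed im_le s(1) t(1)] .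
    have "s \<otimes>\<^bsub>?S\<^esub> t = ?h (s' \<otimes>\<^bsub>?S'\<^esub> t')"
      unfolding s(2) t(2) using hom_mult[OF hom s(1) t(1)] by simp
    then show "inv_into (carrier ?S') ?h (s \<otimes>\<^bsub>?S\<^esub> t) =
        inv_into (carrier ?S') ?h s \<otimes>\<^bsub>?S'\<^esub> inv_into (carrier ?S') ?h t"
      using bij_betw_imp_inj_on[OF bij] s t st by (simp only: inv_into_f_f)
  qed
  then show ?thesis
    unfolding is_iso_def by blast
qed

end
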